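(* For every integer $n\ge 0$, $c_{10}(n)$ is odd if $n=2j^2+j$ for some $j\in\mathbb{Z}$, and $c_{10}(n)$ is even otherwise.
   Context: A partition of $n\ge 0$ is a finite multiset of positive integers summing to $n$; the empty partition is the partition of $0$. For $n\ge 0$, $c_{10}(n)$ denotes the number of partitions $\lambda$ of $n$ such that either (a) all parts of $\lambda$ are distinct, or (b) there is an integer $j\ge 1$ such that: every odd integer $\le j$ appears exactly two or three times; every odd part greater than $j$ appears at most once; every even integer $\le j$ appears exactly twice; no even part lies in the interval $(j,2j]$; and every even part greater than $2j$ appears at most once. *)

theory Defs
  imports Main "HOL-Library.Multiset"
begin

definition partitions :: "nat \<Rightarrow> nat multiset set" where
  "partitions n = {M. (\<forall>x\<in>#M. 0 < x) \<and> sum_mset M = n}"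

definition distinct_parts :: "nat multiset \<Rightarrow> bool" where
  "distinct_parts M \<longleftrightarrow> (\<forall>x. count M x \<le> 1)"

definition cond_b :: "nat \<Rightarrow> nat multiset \<Rightarrow> bool" where
  "cond_b j M \<longleftrightarrow>
     (\<forall>i. odd i \<and> 1 \<le> i \<and> i \<le> j \<longrightarrow> count M i = 2 \<or> count M i = 3) \<and>
     (\<forall>i. odd i \<and> j < i \<longrightarrow> count M i \<le> 1) \<and>
     (\<forall>i. even i \<and> 1 \<le> i \<and> i \<le> j \<longrightarrow> count M i = 2) \<and>
     (\<forall>i. even i \<and> j < i \<and> i \<le> 2 * j \<longrightarrow> count M i = 0) \<and>
     (\<forall>i. even i \<and> 2 * j < i \<longrightarrow> count M i \<le> 1)"

definition c10 :: "nat \<Rightarrow> nat" where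
  "c10 n = card {M \<in> partitions n. distinct_parts M \<or> (\<exists>j\<ge>1. cond_b j M)}"

end

theory Submission
  imports Defs "HOL-Library.Nat_Bijection" "HOL-Library.Z2" "HOL-Computational_Algebra.Formal_Power_Series"
begin

text \<open>
  Reading \<open>distinct_parts\<close> as \<open>cond_b 0\<close>, the partitions counted for a given \<open>j\<close> arise by adding
  two copies of \<open>{1..j}\<close> to a set of distinct parts that are odd or exceed \<open>2 j\<close>. Modulo 2, and with
  \<open>E\<^sub>j = (1 + q) (1 + q\<^sup>2) \<dots> (1 + q\<^sup>j)\<close>, the generating function is therefore
  \<open>E\<^sub>\<infinity> (\<Sum>j. q\<^bsup>j(j+1)/2\<^esup> / E\<^sub>j)\<^sup>2\<close>, because squaring is additive and turns \<open>E\<^sub>j\<close> into the product of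
  the factors \<open>1 + q\<^bsup>2k\<^esup>\<close>. As \<open>E\<^sub>j\<close> agrees with \<open>(q; q)\<^sub>j\<close> modulo 2, Euler's identity evaluates the
  inner sum as \<open>E\<^sub>\<infinity>\<close>, which leaves \<open>E\<^sub>\<infinity>\<^sup>3\<close>. By Gauss's product formula, obtained here from Shanks's
  finite identity, this is \<open>\<Sum>k. q\<^bsup>k(k+1)/2\<^esup>\<close>; and the triangular numbers are exactly the numbers
  \<open>2 j\<^sup>2 + j\<close> with \<open>j\<close> an integer. All series are truncated: they are compared modulo \<open>q\<^bsup>N+1\<^esup>\<close>.
\<close>

section \<open>Congruence modulo a ring element\<close>

definition cong_mod :: "'a::comm_ring_1 \<Rightarrow> 'a \<Rightarrow> 'a \<Rightarrow> bool" where
  "cong_mod c a b \<longleftrightarrow> c dvd a - b"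

lemma cong_mod_refl [simp]: "cong_mod c a a"
  by (simp add: cong_mod_def)

lemma cong_mod_sym: "cong_mod c a b \<Longrightarrow> cong_mod c b a"
  unfolding cong_mod_def by (subst dvd_minus_iff [symmetric]) simp

lemma cong_mod_trans [trans]: "cong_mod c a b \<Longrightarrow> cong_mod c b d \<Longrightarrow> cong_mod c a d"
  unfolding cong_mod_def by (drule (1) dvd_add) simp

lemma cong_mod_mult:
  assumes "cong_mod c a b" "cong_mod c a' b'"
  shows "cong_mod c (a * a') (b * b')"
proof -
  have "a * a' - b * b' = (a - b) * a' + b * (a' - b')"
    by (simp add: algebra_simps)
  then show ?thesis
    using assms unfolding cong_mod_def by simp
qed

lemma cong_mod_power: "cong_mod c a b \<Longrightarrow> cong_mod c (a ^ n) (b ^ n)"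
  by (induction n) (simp_all add: cong_mod_mult)

lemma cong_mod_prod_1: "(\<And>i. i \<in> A \<Longrightarrow> cong_mod c (f i) 1) \<Longrightarrow> cong_mod c (prod f A) 1"
proof (induction A rule: infinite_finite_induct)
  case (insert x A)
  then show ?case
    using cong_mod_mult [of c "f x" 1 "prod f A" 1] by simp
qed simp_all

section \<open>The identities of Shanks and Euler\<close>

text \<open>Here \<open>r k\<close> is the quotient of 1 - q^(2k+2) by 1 - q^(2k+1), fixed by its
  product so that no division occurs. Apart from a boundary term, the sum at \<open>m = n\<close> is
  the increment of Shanks's sum from \<open>n\<close> to \<open>n + 1\<close>; a free upper bound
  \<open>m\<close> lets induction telescope it.\<close>

lemma sum_telescope_Shanks:
  fixes q :: "'a::idom"
  assumes r: "\<And>k. (1 - q ^ (2 * k + 1)) * r k = 1 - q ^ (2 * k + 2)" and "m \<le> n"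
  shows "(1 - q ^ (2 * n + 1)) *
      (\<Sum>s<m. (\<Prod>k=s..<n. r k) * q ^ (s * (2 * n + 1)) * (q ^ (2 * s) * r n - 1)) =
      (1 - q ^ (2 * m)) * (\<Prod>k=m..<n. r k) * q ^ (m * (2 * n + 1))"
  using \<open>m \<le> n\<close>
proof (induction m)
  case 0
  then show ?case by simp
next
  case (Suc m)
  define x y p where "x = q ^ (2 * m)" "y = q ^ (2 * n)" "p = (\<Prod>k=Suc m..<n. r k)"
  define w where "w = q ^ (m * (2 * n + 1))"
  have split: "(\<Prod>k=m..<n. r k) = r m * p"
    using Suc.prems by (simp add: x_y_p_def(3) prod.atLeast_Suc_lessThan)
  have powers: "q ^ (2 * Suc m) = x * q^2" "q ^ (2 * n + 1) = y * q"
    "q ^ (Suc m * (2 * n + 1)) = w * y * q"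
    by (simp_all add: x_y_p_def w_def power_add power2_eq_square algebra_simps)
  have rm: "(1 - x * q) * r m = 1 - x * q^2" and rn: "(1 - y * q) * r n = 1 - y * q^2"
    using r [of m] r [of n] by (simp_all add: x_y_p_def power2_eq_square algebra_simps)
  have "(1 - y * q) * (\<Sum>s<Suc m. (\<Prod>k=s..<n. r k) * q ^ (s * (2 * n + 1)) * (q ^ (2 * s) * r n - 1))
      = (1 - x) * (r m * p) * w + (1 - y * q) * (r m * p * w * (x * r n - 1))"
    using Suc.IH Suc.prems unfolding powers split x_y_p_def(1) [symmetric]
    by (simp add: distrib_left split x_y_p_def(1) [symmetric] w_def del: mult_Suc_right)
  also have "\<dots> = (1 - x) * (r m * p) * w + r m * p * w * (x * ((1 - y * q) * r n) - (1 - y * q))"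
    by (simp add: algebra_simps)
  also have "\<dots> = ((1 - x * q) * r m) * p * (w * y * q)"
    unfolding rn by (simp add: algebra_simps power2_eq_square)
  also have "\<dots> = (1 - x * q^2) * p * (w * y * q)"
    unfolding rm ..
  finally show ?case
    unfolding powers x_y_p_def(3) [symmetric] .
qed

text \<open>Shanks's finite identity: from \<open>n\<close> to \<open>n + 1\<close> both sides grow
  by the powers for \<open>triangle (2 * n)\<close> and \<open>triangle (2 * n + 1)\<close>. The
  hypothesis \<open>nz\<close> allows cancelling 1 - q^(2n+1).\<close>

lemma sum_triangle_powers_Shanks:
  fixes q :: "'a::idom"
  assumes r: "\<And>k. (1 - q ^ (2 * k + 1)) * r k = 1 - q ^ (2 * k + 2)"
    and nz: "\<And>k. q ^ (2 * k + 1) \<noteq> 1"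
  shows "(\<Sum>k<2 * n. q ^ triangle k) = (\<Sum>s<n. (\<Prod>k=s..<n. r k) * q ^ (s * (2 * n + 1)))"
proof (induction n)
  case 0
  then show ?case by simp
next
  case (Suc n)
  define F where "F n = (\<Sum>s<n. (\<Prod>k=s..<n. r k) * q ^ (s * (2 * n + 1)))" for n
  define y w where "y = q ^ (2 * n)" "w = q ^ (n * (2 * n + 1))"
  have w_eq: "q ^ (n * (2 * Suc n + 1)) = w * y" "q ^ (2 * n + 1) = y * q" "q ^ (2 * n + 2) = y * q^2"
    by (simp_all add: y_w_def algebra_simps power2_eq_square flip: power_add)
  have "F (Suc n) = (\<Sum>s<n. (\<Prod>k=s..<n. r k) * r n * (q ^ (s * (2 * n + 1)) * q ^ (2 * s))) + r n * w * y"
    unfolding F_def using w_eq(1)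
    by (simp add: power_add [symmetric] algebra_simps)
  \<comment> \<open>Passing to \<open>Suc n\<close> multiplies the summand at \<open>s\<close> by
    \<open>q ^ (2 * s) * r n\<close>; the new summand \<open>s = n\<close> is
    \<open>r n * w * y\<close>.\<close>
  then have "F (Suc n) - F n =
      (\<Sum>s<n. (\<Prod>k=s..<n. r k) * q ^ (s * (2 * n + 1)) * (q ^ (2 * s) * r n - 1)) + r n * w * y"
    unfolding F_def by (simp add: algebra_simps sum_subtractf)
  moreover have "(1 - y * q) *
      (\<Sum>s<n. (\<Prod>k=s..<n. r k) * q ^ (s * (2 * n + 1)) * (q ^ (2 * s) * r n - 1)) = (1 - y) * w"
    using sum_telescope_Shanks [OF r order_refl, of n]
    unfolding w_eq y_w_def [symmetric] by simp
  ultimately have "(1 - y * q) * (F (Suc n) - F n) = (1 - y) * w + ((1 - y * q) * r n) * w * y"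
    by (simp only: distrib_left mult.assoc)
  \<comment> \<open>Both sides equal w (1 - y^2 q^2), a difference of squares.\<close>
  also have "\<dots> = (1 - y * q) * (w + w * (y * q))"
    using r [of n] unfolding w_eq by (simp only:) (simp add: algebra_simps power2_eq_square)
  finally have step: "F (Suc n) - F n = w + w * (y * q)"
    using nz [of n] unfolding w_eq by simp
  have tri: "triangle (2 * n) = n * (2 * n + 1)" "triangle (Suc (2 * n)) = n * (2 * n + 1) + (2 * n + 1)"
    by (simp_all add: triangle_def)
  have pow_tri: "q ^ triangle (2 * n) = w" "q ^ triangle (Suc (2 * n)) = w * (y * q)"
    unfolding tri power_add [of q "n * (2 * n + 1)"] w_eq(2) y_w_def by (rule refl)+
  have "(\<Sum>k<2 * Suc n. q ^ triangle k) = F n + w + w * (y * q)"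
    using Suc.IH unfolding F_def [symmetric]
    by (simp add: pow_tri del: triangle_Suc)
  with step show ?case
    unfolding F_def [symmetric] by (simp add: algebra_simps)
qed

text \<open>The recurrence makes \<open>e j\<close> the reciprocal of (1 - q) ... (1 - q^j), so this
  is Euler's expansion of the product of all 1 + q^i, truncated.\<close>

lemma Euler_sum_triangle_cong:
  fixes q :: "'a::comm_ring_1"
  assumes e0: "e 0 = 1" and e: "\<And>j. (1 - q ^ Suc j) * e (Suc j) = e j"
  shows "cong_mod (q ^ Suc N) (\<Sum>j\<le>N. q ^ triangle j * e j) (\<Prod>i=1..N. 1 + q ^ i)"
proof -
  \<comment> \<open>Up to truncation, \<open>f J s = (1 + q\<^bsup>s+1\<^esup>) * f J (s + 1)\<close>, and \<open>f J s\<close> tends to 1 as \<open>s\<close> grows.\<close>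
  define f where "f J s = (\<Sum>j\<le>J. q ^ (triangle j + s * j) * e j)" for J s
  have step: "f (Suc J) s = f (Suc J) (Suc s) + q ^ Suc s * f J (Suc s)" for J s
  proof -
    have "f (Suc J) s - f (Suc J) (Suc s) = (\<Sum>j\<le>Suc J. q ^ (triangle j + s * j) * (1 - q ^ j) * e j)"
      unfolding f_def by (simp only: sum_subtractf [symmetric]) (simp add: algebra_simps power_add)
    also have "\<dots> = (\<Sum>j\<le>J. q ^ (triangle (Suc j) + s * Suc j) * ((1 - q ^ Suc j) * e (Suc j)))"
      by (subst sum.atMost_Suc_shift) (simp add: mult.assoc)
    also have "\<dots> = q ^ Suc s * f J (Suc s)"
      unfolding e f_def sum_distrib_left
      by (rule sum.cong) (simp_all add: power_add algebra_simps)
    finally show ?thesis by (simp add: algebra_simps)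
  qed
  have shift: "cong_mod (q ^ Suc N) (f N s) ((1 + q ^ Suc s) * f N (Suc s))" for s
  proof (cases N)
    case 0
    then show ?thesis by (simp add: f_def cong_mod_def e0)
  next
    case (Suc J)
    \<comment> \<open>The recurrence lowers \<open>J\<close> by one, so the defect is the top term
      \<open>j = N\<close> of \<open>f N (Suc s)\<close> times \<open>q ^ Suc s\<close>; together
      these contain \<open>q ^ Suc N\<close>.\<close>
    have "f N s - (1 + q ^ Suc s) * f N (Suc s) = - (q ^ Suc s * (q ^ (triangle N + Suc s * N) * e N))"
      using step [of J s] unfolding Suc f_def by (simp add: algebra_simps)
    also have "\<dots> = - (q ^ Suc N * (q ^ (triangle N + s * N + s) * e N))"
      by (simp add: power_add algebra_simps)
    finally show ?thesis by (simp add: cong_mod_def)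
  qed
  have iter: "cong_mod (q ^ Suc N) (f N 0) ((\<Prod>i=1..m. 1 + q ^ i) * f N m)" for m
  proof (induction m)
    case (Suc m)
    also have "cong_mod (q ^ Suc N) ((\<Prod>i=1..m. 1 + q ^ i) * f N m)
        ((\<Prod>i=1..m. 1 + q ^ i) * ((1 + q ^ Suc m) * f N (Suc m)))"
      by (intro cong_mod_mult shift) simp
    finally show ?case by (simp add: mult.assoc)
  qed simp
  have "f N N = 1 + (\<Sum>j=1..N. q ^ (triangle j + N * j) * e j)"
    unfolding f_def by (simp add: e0 atMost_atLeast0 sum.atLeast_Suc_atMost)
  moreover have "q ^ Suc N dvd q ^ (triangle j + N * j) * e j" if "j \<in> {1..N}" for j
    using that by (intro dvd_mult2 le_imp_power_dvd) (cases j, auto)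
  then have "q ^ Suc N dvd (\<Sum>j=1..N. q ^ (triangle j + N * j) * e j)"
    by (rule dvd_sum)
  ultimately have "cong_mod (q ^ Suc N) (f N N) 1"
    by (simp add: cong_mod_def)
  then have "cong_mod (q ^ Suc N) ((\<Prod>i=1..N. 1 + q ^ i) * f N N) (\<Prod>i=1..N. 1 + q ^ i)"
    using cong_mod_mult [OF cong_mod_refl] by force
  from cong_mod_trans [OF iter this] show ?thesis
    by (simp add: f_def)
qed


lemma cong_mod_fps_X_power_nth:
  assumes "cong_mod (fps_X ^ Suc N) f g" "n \<le> N"
  shows "fps_nth f n = fps_nth g n"
proof -
  from assms(1) obtain h where "f - g = fps_X ^ Suc N * h"
    unfolding cong_mod_def by blast
  then have "fps_nth (f - g) n = 0"
    using assms(2) by (simp add: fps_X_power_mult_nth del: power_Suc)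
  then show ?thesis by simp
qed

section \<open>Products over the field with two elements\<close>

lemma of_nat_bit_eq_1_iff: "of_nat m = (1::bit) \<longleftrightarrow> odd m"
  by (induction m) auto

lemma bit_fps_diff_eq_add: "a - b = a + (b :: bit fps)"
  by (simp add: fps_eq_iff)

lemma bit_fps_add_self: "a + a = (0 :: bit fps)"
  by (simp flip: bit_fps_diff_eq_add)

lemma bit_fps_power2_add: "(a + b)\<^sup>2 = a\<^sup>2 + (b :: bit fps)\<^sup>2"
proof -
  have "(a + b)\<^sup>2 = a\<^sup>2 + b\<^sup>2 + (a * b + a * b)"
    by (simp add: power2_eq_square algebra_simps)
  then show ?thesis by (simp only: bit_fps_add_self add_0_right)
qed

lemma bit_fps_power2_sum: "(\<Sum>x\<in>A. f x)\<^sup>2 = (\<Sum>x\<in>A. (f x :: bit fps)\<^sup>2)"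
  by (induction A rule: infinite_finite_induct) (simp_all add: bit_fps_power2_add)

definition euler_prod :: "nat \<Rightarrow> bit fps" where
  "euler_prod N = (\<Prod>i=1..N. 1 + fps_X ^ i)"

definition odd_prod :: "nat \<Rightarrow> bit fps" where
  "odd_prod N = (\<Prod>k<N. 1 + fps_X ^ (2 * k + 1))"

lemma euler_prod_0 [simp]: "euler_prod 0 = 1"
  by (simp add: euler_prod_def)

lemma euler_prod_Suc: "euler_prod (Suc N) = euler_prod N * (1 + fps_X ^ Suc N)"
  by (simp add: euler_prod_def)

lemma euler_prod_nth_0: "fps_nth (euler_prod N) 0 = 1"
  by (induction N) (simp_all add: euler_prod_Suc)

lemma inverse_euler_prod: "inverse (euler_prod N) * euler_prod N = 1"
  by (rule inverse_mult_eq_1) (simp add: euler_prod_nth_0)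

lemma euler_prod_power2: "(euler_prod N)\<^sup>2 = (\<Prod>k=1..N. 1 + fps_X ^ (2 * k))"
  by (simp add: euler_prod_def prod_power_distrib bit_fps_power2_add mult.commute flip: power_mult)

text \<open>In characteristic 2 the square supplies the factors with even exponents,
  \<open>odd_prod\<close> those with odd ones.\<close>

lemma odd_prod_mult_euler_prod: "odd_prod N * (euler_prod N)\<^sup>2 = euler_prod (2 * N)"
  unfolding euler_prod_power2
  by (induction N) (simp_all add: odd_prod_def euler_prod_Suc algebra_simps)

lemma euler_prod_double_cong: "cong_mod (fps_X ^ Suc N) (euler_prod (2 * N)) (euler_prod N)"
proof -
  have "{1..2 * N} = {1..N} \<union> {Suc N..2 * N}" by auto
  then have "euler_prod (2 * N) = euler_prod N * (\<Prod>i=Suc N..2 * N. 1 + fps_X ^ i)"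
    unfolding euler_prod_def by (simp add: prod.union_disjoint)
  moreover have "cong_mod (fps_X ^ Suc N) (\<Prod>i=Suc N..2 * N. 1 + fps_X ^ i :: bit fps) 1"
    by (rule cong_mod_prod_1) (simp add: cong_mod_def le_imp_power_dvd del: power_Suc)
  ultimately show ?thesis
    using cong_mod_mult [OF cong_mod_refl, of _ _ 1 "euler_prod N"] by simp
qed

text \<open>Euler's identity applies with \<open>e j = inverse (euler_prod j)\<close> because signs
  do not matter over \<open>bit\<close>.\<close>

lemma sum_triangle_div_euler_prod_cong:
  "cong_mod (fps_X ^ Suc N) (\<Sum>j\<le>N. fps_X ^ triangle j * inverse (euler_prod j)) (euler_prod N)"
  unfolding euler_prod_def [of N]
proof (rule Euler_sum_triangle_cong)
  fix j
  have "(1 + fps_X ^ Suc j) * inverse (1 + fps_X ^ Suc j :: bit fps) = 1"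
    by (rule inverse_mult_eq_1') simp
  then show "(1 - fps_X ^ Suc j) * inverse (euler_prod (Suc j)) = inverse (euler_prod j)"
    unfolding bit_fps_diff_eq_add euler_prod_Suc fps_inverse_mult
    by (simp only: mult.left_commute [of _ "inverse (euler_prod j)"] mult_1_right)
qed simp

text \<open>Gauss's formula modulo 2. Truncation leaves only the term \<open>s = 0\<close> of
  Shanks's sum, which is \<open>(euler_prod N)\<^sup>2\<close> divided by \<open>odd_prod N\<close>;
  and \<open>euler_prod N\<close> is inverse to \<open>odd_prod N\<close> up to truncation.\<close>

lemma euler_prod_power3_cong:
  assumes "N > 0"
  shows "cong_mod (fps_X ^ Suc N) (\<Sum>k<2 * N. fps_X ^ triangle k) ((euler_prod N) ^ 3)"
proof -
  define r :: "nat \<Rightarrow> bit fps" where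
    "r k = inverse (1 + fps_X ^ (2 * k + 1)) * (1 + fps_X ^ (2 * k + 2))" for k
  have inv: "(1 + fps_X ^ (2 * k + 1)) * inverse (1 + fps_X ^ (2 * k + 1) :: bit fps) = 1" for k
    by (rule inverse_mult_eq_1') simp
  have r: "(1 + fps_X ^ (2 * k + 1)) * r k = 1 + fps_X ^ (2 * k + 2)" for k
    unfolding r_def mult.assoc [symmetric] inv by simp
  have nz: "fps_X ^ (2 * k + 1) \<noteq> (1 :: bit fps)" for k
  proof
    assume "fps_X ^ (2 * k + 1) = (1 :: bit fps)"
    then have "fps_nth (fps_X ^ (2 * k + 1) :: bit fps) 0 = fps_nth 1 0" by (rule arg_cong)
    then show False by (simp del: power_Suc)
  qed
  define S :: "bit fps" where "S = (\<Sum>k<2 * N. fps_X ^ triangle k)"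
  have "S = (\<Sum>s<N. (\<Prod>k=s..<N. r k) * fps_X ^ (s * (2 * N + 1)))"
    unfolding S_def using r nz by (intro sum_triangle_powers_Shanks) (simp_all only: bit_fps_diff_eq_add not_False_eq_True)
  also have "\<dots> = (\<Prod>k<N. r k) + (\<Sum>s=1..<N. (\<Prod>k=s..<N. r k) * fps_X ^ (s * (2 * N + 1)))"
    unfolding lessThan_atLeast0 sum.atLeast_Suc_lessThan [OF assms] by simp
  finally have "S - (\<Prod>k<N. r k) = (\<Sum>s=1..<N. (\<Prod>k=s..<N. r k) * fps_X ^ (s * (2 * N + 1)))"
    by simp
  moreover have "fps_X ^ Suc N dvd (\<Sum>s=1..<N. (\<Prod>k=s..<N. r k) * fps_X ^ (s * (2 * N + 1)))"
  proof (intro dvd_sum dvd_mult le_imp_power_dvd)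
    fix s assume "s \<in> {1..<N}"
    then have "1 * (2 * N + 1) \<le> s * (2 * N + 1)" by (intro mult_le_mono1) simp
    then show "Suc N \<le> s * (2 * N + 1)" by simp
  qed
  ultimately have "cong_mod (fps_X ^ Suc N) S (\<Prod>k<N. r k)"
    unfolding cong_mod_def by simp
  then have "cong_mod (fps_X ^ Suc N) (odd_prod N * S) (odd_prod N * (\<Prod>k<N. r k))"
    by (intro cong_mod_mult) simp_all
  also have "odd_prod N * (\<Prod>k<N. r k) = (euler_prod N)\<^sup>2"
  proof -
    have "odd_prod N * (\<Prod>k<N. r k) = (\<Prod>k<N. 1 + fps_X ^ (2 * k + 2))"
      by (simp only: odd_prod_def prod.distrib [symmetric] r)
    also have "\<dots> = (\<Prod>k<N. 1 + fps_X ^ (2 * Suc k))"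
      by simp
    also have "\<dots> = (\<Prod>k=1..N. 1 + fps_X ^ (2 * k))"
      by (simp only: One_nat_def prod.atLeast1_atMost_eq)
    finally show ?thesis by (simp add: euler_prod_power2)
  qed
  finally have OS: "cong_mod (fps_X ^ Suc N) (odd_prod N * S) ((euler_prod N)\<^sup>2)" .
  \<comment> \<open>Cancelling one \<open>euler_prod N\<close> from the congruence of
    \<open>euler_prod (2 * N)\<close> with \<open>euler_prod N\<close> shows that
    \<open>odd_prod N * euler_prod N\<close> is congruent to 1.\<close>
  have "cong_mod (fps_X ^ Suc N) (inverse (euler_prod N) * (odd_prod N * (euler_prod N)\<^sup>2))
      (inverse (euler_prod N) * euler_prod N)"
    unfolding odd_prod_mult_euler_prod by (intro cong_mod_mult euler_prod_double_cong) simp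
  moreover have "inverse (euler_prod N) * (odd_prod N * (euler_prod N)\<^sup>2) =
      (inverse (euler_prod N) * euler_prod N) * (odd_prod N * euler_prod N)"
    by (simp only: power2_eq_square mult_ac)
  ultimately have "cong_mod (fps_X ^ Suc N) (odd_prod N * euler_prod N) 1"
    by (simp add: inverse_euler_prod del: power_Suc)
  from cong_mod_sym [OF cong_mod_mult [OF this cong_mod_refl [of _ S]]]
  have "cong_mod (fps_X ^ Suc N) S (euler_prod N * (odd_prod N * S))"
    by (simp add: mult_ac del: power_Suc)
  also have "cong_mod (fps_X ^ Suc N) (euler_prod N * (odd_prod N * S)) (euler_prod N * (euler_prod N)\<^sup>2)"
    by (intro cong_mod_mult OS) simp
  finally show ?thesis
    by (simp add: S_def power3_eq_cube power2_eq_square mult.assoc del: power_Suc)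
qed

section \<open>Products over the parts that may occur one extra time\<close>

definition single_parts :: "nat \<Rightarrow> nat \<Rightarrow> nat set" where
  "single_parts N j = {i \<in> {1..2 * N}. odd i \<or> 2 * j < i}"

lemma finite_single_parts [simp]: "finite (single_parts N j)"
  by (simp add: single_parts_def)

text \<open>The numbers missing from \<open>{1..2 * N}\<close> are 2, 4, ..., 2j, whose factors
  multiply to \<open>(euler_prod j)\<^sup>2\<close>. The range ends at \<open>2 * N\<close> so that
  all of them lie in it for every \<open>j \<le> N\<close>.\<close>

lemma prod_single_parts:
  assumes "j \<le> N"
  shows "(\<Prod>i\<in>single_parts N j. 1 + fps_X ^ i) = euler_prod (2 * N) * (inverse (euler_prod j))\<^sup>2"
proof -
  have "{1..2 * N} = single_parts N j \<union> (\<lambda>k. 2 * k) ` {1..j}"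
    using assms by (auto simp: single_parts_def elim!: evenE)
  moreover have "single_parts N j \<inter> (\<lambda>k. 2 * k) ` {1..j} = {}"
    by (auto simp: single_parts_def)
  ultimately have "euler_prod (2 * N) =
      (\<Prod>i\<in>single_parts N j. 1 + fps_X ^ i) * (\<Prod>i\<in>(\<lambda>k. 2 * k) ` {1..j}. 1 + fps_X ^ i)"
    unfolding euler_prod_def by (simp add: prod.union_disjoint)
  also have "(\<Prod>i\<in>(\<lambda>k. 2 * k) ` {1..j}. 1 + fps_X ^ i) = (euler_prod j)\<^sup>2"
    by (subst prod.reindex) (simp_all add: inj_on_def euler_prod_power2)
  finally have "euler_prod (2 * N) * (inverse (euler_prod j))\<^sup>2 =
      (\<Prod>i\<in>single_parts N j. 1 + fps_X ^ i) * (inverse (euler_prod j) * euler_prod j)\<^sup>2"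
    by (simp add: power_mult_distrib mult_ac)
  then show ?thesis by (simp add: inverse_euler_prod)
qed

lemma sum_prod_single_parts_cong:
  "cong_mod (fps_X ^ Suc N)
     (\<Sum>j\<le>N. fps_X ^ (2 * triangle j) * (\<Prod>i\<in>single_parts N j. 1 + fps_X ^ i))
     ((euler_prod N) ^ 3)"
proof -
  have "(\<Sum>j\<le>N. fps_X ^ (2 * triangle j) * (\<Prod>i\<in>single_parts N j. 1 + fps_X ^ i)) =
      (\<Sum>j\<le>N. euler_prod (2 * N) * (fps_X ^ triangle j * inverse (euler_prod j))\<^sup>2)"
    by (rule sum.cong)
      (simp_all add: prod_single_parts power_mult_distrib mult_ac flip: power_mult)
  also have "\<dots> = euler_prod (2 * N) * (\<Sum>j\<le>N. fps_X ^ triangle j * inverse (euler_prod j))\<^sup>2"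
    by (simp add: bit_fps_power2_sum sum_distrib_left)
  also have "cong_mod (fps_X ^ Suc N) \<dots> (euler_prod N * (euler_prod N)\<^sup>2)"
    by (intro cong_mod_mult cong_mod_power euler_prod_double_cong sum_triangle_div_euler_prod_cong)
  finally show ?thesis
    by (simp add: power3_eq_cube power2_eq_square mult.assoc del: power_Suc)
qed

section \<open>Counting the partitions\<close>

definition doubled_staircase :: "nat \<Rightarrow> nat set \<Rightarrow> nat multiset" where
  "doubled_staircase j A = mset_set {1..j} + mset_set {1..j} + mset_set A"

lemma sum_mset_mset_set: "sum_mset (mset_set A) = \<Sum>A"
  using sum_unfold_sum_mset [of "\<lambda>x. x" A] by simp

lemma sum_upto_eq_triangle: "\<Sum>{1..j} = triangle j"
  by (induction j) simp_all

lemma sum_mset_doubled_staircase: "sum_mset (doubled_staircase j A) = 2 * triangle j + \<Sum>A"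
  by (simp add: doubled_staircase_def sum_mset_mset_set sum_upto_eq_triangle [unfolded One_nat_def])

lemma count_doubled_staircase:
  "finite A \<Longrightarrow> count (doubled_staircase j A) i = 2 * of_bool (i \<in> {1..j}) + of_bool (i \<in> A)"
  by (simp add: doubled_staircase_def count_mset_set')

text \<open>The parity of the multiplicities recovers the set, and then the size recovers
  \<open>j\<close>.\<close>

lemma inj_doubled_staircase:
  assumes "finite A" "finite B" "doubled_staircase j A = doubled_staircase k B"
  shows "j = k \<and> A = B"
proof -
  have "i \<in> A \<longleftrightarrow> i \<in> B" for i
  proof -
    have "even (count (doubled_staircase j A) i) \<longleftrightarrow> even (count (doubled_staircase k B) i)"
      by (simp add: assms(3))
    then show ?thesis
      using assms(1,2) by (cases "i \<in> A"; cases "i \<in> B") (simp_all add: count_doubled_staircase)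
  qed
  then have "A = B" by blast
  moreover from this assms(3) have "size (doubled_staircase j A) = size (doubled_staircase k A)"
    by simp
  then have "j = k" by (simp add: doubled_staircase_def)
  ultimately show ?thesis by simp
qed

text \<open>Makes case (a) the instance \<open>j = 0\<close> of case (b). As \<open>cond_b 0\<close>
  does not constrain the multiplicity of 0, that value is excluded by hypothesis.\<close>

lemma distinct_parts_iff_cond_b_0:
  assumes "0 \<notin># M"
  shows "distinct_parts M \<longleftrightarrow> cond_b 0 M"
proof -
  have "count M 0 = 0" using assms by (simp add: not_in_iff)
  then have "(\<forall>x. count M x \<le> 1) \<longleftrightarrow> (\<forall>x>0. count M x \<le> 1)"
    by (metis gr0I zero_le)
  then show ?thesis
    unfolding distinct_parts_def cond_b_def by auto
qed

lemma cond_b_iff_doubled_staircase: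
  assumes "0 \<notin># M"
  shows "cond_b j M \<longleftrightarrow> (\<exists>A. finite A \<and> (\<forall>i\<in>A. odd i \<or> 2 * j < i) \<and> M = doubled_staircase j A)"
proof
  assume b: "cond_b j M"
  \<comment> \<open>The two copies of \<open>{1..j}\<close> contribute evenly, so \<open>A\<close>
    has to consist of the elements of odd multiplicity.\<close>
  define A where "A = {i. odd (count M i)}"
  have "A \<subseteq> set_mset M" unfolding A_def by (auto simp: not_in_iff intro: ccontr)
  then have "finite A" by (rule finite_subset) simp
  have "odd i \<or> 2 * j < i" if "i \<in> A" for i
  proof (rule ccontr)
    assume "\<not> (odd i \<or> 2 * j < i)"
    moreover from this have "i \<noteq> 0 \<or> count M i = 0" using assms by (metis not_in_iff)
    ultimately have "count M i = 2 \<or> count M i = 0"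
      using b unfolding cond_b_def by (cases "i \<le> j") (auto simp: Suc_le_eq)
    then show False using that by (auto simp: A_def)
  qed
  moreover have "M = doubled_staircase j A"
  proof (rule multiset_eqI)
    fix i
    have "count M 0 = 0" using assms by (simp add: not_in_iff)
    then consider "i = 0" "count M i = 0" | "1 \<le> i" "i \<le> j" "count M i = 2 \<or> count M i = 3"
      | "j < i" "count M i \<le> 1"
      using b unfolding cond_b_def by (metis One_nat_def Suc_le_eq bot_nat_0.not_eq_extremum
        not_le zero_le)
    then show "count M i = count (doubled_staircase j A) i"
      unfolding count_doubled_staircase [OF \<open>finite A\<close>]
      by cases (auto simp: A_def le_Suc_eq)
  qed
  ultimately show "\<exists>A. finite A \<and> (\<forall>i\<in>A. odd i \<or> 2 * j < i) \<and> M = doubled_staircase j A"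
    using \<open>finite A\<close> by blast
next
  assume "\<exists>A. finite A \<and> (\<forall>i\<in>A. odd i \<or> 2 * j < i) \<and> M = doubled_staircase j A"
  then obtain A where A: "finite A" "\<forall>i\<in>A. odd i \<or> 2 * j < i" "M = doubled_staircase j A"
    by blast
  show "cond_b j M"
    unfolding cond_b_def A(3) count_doubled_staircase [OF A(1)] using A(2) by fastforce
qed

text \<open>The pairs \<open>(j, A)\<close> correspond bijectively to the counted partitions. Both
  \<open>j\<close> and the elements of \<open>A\<close> are at most \<open>n\<close>, so truncating
  at \<open>N\<close> loses nothing.\<close>

lemma c10_eq_sum_card:
  assumes "n \<le> N"
  shows "c10 n = (\<Sum>j\<le>N. card {A \<in> Pow (single_parts N j). 2 * triangle j + \<Sum>A = n})"
proof -
  define X where "X j = {A \<in> Pow (single_parts N j). 2 * triangle j + \<Sum>A = n}" for j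
  have fin: "finite (X j)" for j
    unfolding X_def by simp
  have fin_mem: "finite A" if "A \<in> X j" for A j
    using that finite_subset [OF _ finite_single_parts] unfolding X_def by blast
  have "{M \<in> partitions n. distinct_parts M \<or> (\<exists>j\<ge>1. cond_b j M)} =
      (\<lambda>(j, A). doubled_staircase j A) ` (SIGMA j:{..N}. X j)" (is "?L = ?R")
  proof (intro equalityI subsetI)
    fix M assume M: "M \<in> ?L"
    then have z: "0 \<notin># M" by (auto simp: partitions_def)
    with M obtain j where "cond_b j M"
      by (auto simp: distinct_parts_iff_cond_b_0)
    with z obtain A where A: "finite A" "\<forall>i\<in>A. odd i \<or> 2 * j < i" "M = doubled_staircase j A"
      unfolding cond_b_iff_doubled_staircase [OF z] by blast
    have n: "2 * triangle j + \<Sum>A = n"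
      using M by (simp add: A(3) partitions_def sum_mset_doubled_staircase)
    have "j \<le> 2 * triangle j" by (cases j) simp_all
    then have "j \<le> N" using n assms by simp
    moreover have "A \<subseteq> single_parts N j"
    proof
      fix i assume i: "i \<in> A"
      then have "i \<le> \<Sum>A" using A(1) member_le_sum [of i A "\<lambda>x. x"] by simp
      moreover have "odd i \<or> 2 * j < i" using A(2) i by blast
      ultimately show "i \<in> single_parts N j"
        using n assms by (cases "i = 0") (simp_all add: single_parts_def)
    qed
    ultimately show "M \<in> ?R" using n A(3) by (auto simp: X_def)
  next
    fix M assume "M \<in> ?R"
    then obtain j A where A: "A \<in> X j" "M = doubled_staircase j A" by auto
    then have "finite A" by (simp add: fin_mem)
    have z: "0 \<notin># M"
      using A by (auto simp: not_in_iff count_doubled_staircase \<open>finite A\<close> X_def single_parts_def)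
    have "\<forall>i\<in>A. odd i \<or> 2 * j < i" using A(1) by (auto simp: X_def single_parts_def)
    then have "cond_b j M"
      unfolding cond_b_iff_doubled_staircase [OF z] using A(2) \<open>finite A\<close> by blast
    then have "distinct_parts M \<or> (\<exists>j\<ge>1. cond_b j M)"
      unfolding distinct_parts_iff_cond_b_0 [OF z] by (cases j) auto
    moreover have "M \<in> partitions n"
      using A z by (auto simp: partitions_def X_def sum_mset_doubled_staircase intro: gr0I)
    ultimately show "M \<in> ?L" by simp
  qed
  moreover have "inj_on (\<lambda>(j, A). doubled_staircase j A) (SIGMA j:{..N}. X j)"
  proof (intro inj_onI, clarify)
    fix j A k B
    assume "A \<in> X j" "B \<in> X k" "doubled_staircase j A = doubled_staircase k B"
    then show "j = k \<and> A = B" by (intro inj_doubled_staircase) (auto dest: fin_mem)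
  qed
  ultimately have "c10 n = card (SIGMA j:{..N}. X j)"
    by (simp add: c10_def card_image)
  then show ?thesis by (simp add: fin X_def)
qed

section \<open>From counts to coefficients\<close>

lemma prod_one_plus_fps_X_power:
  assumes "finite P"
  shows "(\<Prod>i\<in>P. 1 + fps_X ^ i) = (\<Sum>A\<in>Pow P. fps_X ^ \<Sum>A :: 'a::comm_ring_1 fps)"
  using prod_add [OF assms, of "\<lambda>i. fps_X ^ i" "\<lambda>_. 1 :: 'a fps"]
  by (simp add: add.commute power_sum)

text \<open>The truncated generating function, valid over any commutative ring; over
  \<open>bit\<close> its coefficients record parity.\<close>

lemma of_nat_c10:
  assumes "n \<le> N"
  shows "of_nat (c10 n) = (fps_nth (\<Sum>j\<le>N. fps_X ^ (2 * triangle j) *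
    (\<Prod>i\<in>single_parts N j. 1 + fps_X ^ i)) n :: 'a::comm_ring_1)"
  (is "_ = fps_nth ?G n")
proof -
  have "?G = (\<Sum>j\<le>N. \<Sum>A\<in>Pow (single_parts N j). fps_X ^ (2 * triangle j + \<Sum>A))"
    by (simp add: prod_one_plus_fps_X_power sum_distrib_left power_add)
  then show ?thesis
    by (simp add: c10_eq_sum_card [OF assms] fps_sum_nth sum.If_cases Int_def eq_commute)
qed

text \<open>The index \<open>k = 2 * m\<close> corresponds to \<open>j = m\<close>, and
  \<open>k = 2 * m + 1\<close> to \<open>j = - m - 1\<close>.\<close>

lemma triangle_eq_iff_exists_int:
  "(\<exists>k. triangle k = n) \<longleftrightarrow> (\<exists>j::int. int n = 2 * j\<^sup>2 + j)"
proof
  assume "\<exists>k. triangle k = n"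
  then obtain k where k: "triangle k = n" ..
  show "\<exists>j::int. int n = 2 * j\<^sup>2 + j"
  proof (cases "even k")
    case True
    then obtain m where "k = 2 * m" ..
    then have "int n = 2 * (int m)\<^sup>2 + int m"
      using k by (auto simp: triangle_def power2_eq_square algebra_simps)
    then show ?thesis ..
  next
    case False
    then obtain m where "k = 2 * m + 1" ..
    then have "n = (m + 1) * (2 * m + 1)"
      using k by (auto simp: triangle_def)
    then have "int n = 2 * (- int m - 1)\<^sup>2 + (- int m - 1)"
      by (simp add: power2_eq_square algebra_simps)
    then show ?thesis ..
  qed
next
  assume "\<exists>j::int. int n = 2 * j\<^sup>2 + j"
  then obtain j :: int where j: "int n = 2 * j\<^sup>2 + j" ..
  show "\<exists>k. triangle k = n"
  proof (cases "j \<ge> 0")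
    case True
    then obtain m where "j = int m" by (metis nonneg_int_cases)
    with j have "int n = int (m * (2 * m + 1))" by (simp add: power2_eq_square algebra_simps)
    then have "n = m * (2 * m + 1)" by (simp only: of_nat_eq_iff)
    then have "triangle (2 * m) = n" by (simp add: triangle_def)
    then show ?thesis ..
  next
    case False
    define m where "m = nat (- j - 1)"
    have "j = - int m - 1" using False by (simp add: m_def)
    with j have "int n = int ((m + 1) * (2 * m + 1))" by (simp add: power2_eq_square algebra_simps)
    then have "n = (m + 1) * (2 * m + 1)" by (simp only: of_nat_eq_iff)
    then have "triangle (2 * m + 1) = n" by (simp add: triangle_def)
    then show ?thesis ..
  qed
qed

lemma strict_mono_triangle: "strict_mono triangle"
  by (simp add: strict_mono_Suc_iff)

lemma sum_triangle_nth:
  assumes "n < 2 * N"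
  shows "fps_nth (\<Sum>k<2 * N. fps_X ^ triangle k :: bit fps) n = of_bool (\<exists>k. triangle k = n)"
proof (cases "\<exists>k. triangle k = n")
  case True
  then obtain k where k: "triangle k = n" ..
  then have "k \<le> n" by (cases k) auto
  have "(n = triangle i) = (i = k)" for i
    using k strict_mono_eq [OF strict_mono_triangle] by metis
  then show ?thesis
    using True \<open>k \<le> n\<close> assms by (simp add: fps_sum_nth)
next
  case False
  then show ?thesis by (auto simp: fps_sum_nth intro!: sum.neutral)
qed

theorem theorem11:
  fixes n :: nat
  shows "odd (c10 n) \<longleftrightarrow> (\<exists>j::int. int n = 2 * j^2 + j)"
proof -
  \<comment> \<open>The successor keeps \<open>N\<close> positive when \<open>n = 0\<close>, as
    Gauss's formula requires.\<close>
  define N where "N = Suc n"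
  have "n \<le> N" "n < 2 * N" "N > 0" by (simp_all add: N_def)
  have "of_nat (c10 n) = fps_nth ((euler_prod N) ^ 3) n"
    unfolding of_nat_c10 [OF \<open>n \<le> N\<close>]
    using cong_mod_fps_X_power_nth [OF sum_prod_single_parts_cong \<open>n \<le> N\<close>] .
  also have "\<dots> = fps_nth (\<Sum>k<2 * N. fps_X ^ triangle k) n"
    using cong_mod_fps_X_power_nth [OF euler_prod_power3_cong [OF \<open>N > 0\<close>] \<open>n \<le> N\<close>] by simp
  also have "\<dots> = of_bool (\<exists>k. triangle k = n)"
    by (rule sum_triangle_nth) fact
  finally have "of_nat (c10 n) = (1::bit) \<longleftrightarrow> (\<exists>k. triangle k = n)"
    by simp
  then show ?thesis
    by (simp only: of_nat_bit_eq_1_iff triangle_eq_iff_exists_int)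
qed

end
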